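(* Let $A=(a_{ij})\in\mathbb{R}^{m\times n}$ be an arbitrary nonzero matrix, let $b\in\mathbb{R}^m$, and suppose the linear system $Ax=b$ is consistent. Let $$\alpha=\frac{1}{\|A\|_F^2}\,\underline{\lambda}_{\min}(AA^T),$$ where $\underline{\lambda}_{\min}(AA^T)$ is the minimum nonzero eigenvalue of $AA^T$. Let $x^{+}$ be the (random) point obtained from $x\in\mathbb{R}^n$ by one iteration of the doubly stochastic Gauss-Seidel algorithm with stepsize $\alpha$ (described in the context), and let $\beta=Ax-b$ and $\beta^{+}=Ax^{+}-b$. Then $$\mathbb{E}\left[\|\beta^{+}\|^2\mid x\right]\le\|\beta\|^2\left(1-\left(\frac{1}{\|A\|_F^2}\,\underline{\lambda}_{\min}(AA^T)\right)^2\right).$$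
   Context: Doubly stochastic Gauss-Seidel algorithm for $Ax=b$ with stepsize $\alpha>0$: given the current iterate $x\in\mathbb{R}^n$, select one index pair $(i,j)\in\{1,\dots,m\}\times\{1,\dots,n\}$ with probability $p_{ij}=a_{ij}^2/\sum_{i',j'}a_{i'j'}^2$ (so pairs with $a_{ij}=0$ are never selected), and set $$x_j^{+}=x_j+\alpha\,\frac{b_i-\sum_{k=1}^n a_{ik}x_k}{a_{ij}},\qquad x_k^{+}=x_k\ \text{ for all } k\ne j .$$ Here $\|\cdot\|$ is the Euclidean norm and $\|A\|_F$ is the Frobenius norm. *)

theory Defs
  imports "HOL-Probability.Probability"
begin

text \<open>
  The library norm on \<^typ>\<open>real^'n^'m\<close> is the Frobenius norm (not the operator norm):
\<close>

lemma norm_matrix_eq_frobenius: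
  fixes A :: "real^'n^'m"
  shows "norm A = sqrt (\<Sum>i\<in>UNIV. \<Sum>j\<in>UNIV. (A $ i $ j)\<^sup>2)"
  by (simp add: norm_vec_def L2_set_def sum_nonneg)

definition eigenvalue :: "real^'n^'n \<Rightarrow> real \<Rightarrow> bool" where
  "eigenvalue M l \<longleftrightarrow> (\<exists>v. v \<noteq> 0 \<and> M *v v = l *\<^sub>R v)"

text \<open>Only meaningful if \<open>M\<close> has a nonzero real eigenvalue, e.g. \<open>M\<close> symmetric and nonzero.\<close>

definition min_nonzero_eigenvalue :: "real^'n^'n \<Rightarrow> real" where
  "min_nonzero_eigenvalue M = Min {l. eigenvalue M l \<and> l \<noteq> 0}"

text \<open>For \<open>A = 0\<close> the weights below do not sum to \<open>1\<close>, and the distribution is unspecified.\<close>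

definition dsgs_index_pmf :: "real^'n^'m \<Rightarrow> ('m \<times> 'n) pmf" where
  "dsgs_index_pmf A =
     embed_pmf (\<lambda>(i, j). (A $ i $ j)\<^sup>2 / (\<Sum>i'\<in>UNIV. \<Sum>j'\<in>UNIV. (A $ i' $ j')\<^sup>2))"

lemma pmf_dsgs_index_pmf:
  fixes A :: "real^'n^'m"
  assumes "A \<noteq> 0"
  shows "pmf (dsgs_index_pmf A) (i, j) =
           (A $ i $ j)\<^sup>2 / (\<Sum>i'\<in>UNIV. \<Sum>j'\<in>UNIV. (A $ i' $ j')\<^sup>2)"
proof -
  define S where "S = (\<Sum>i'\<in>UNIV. \<Sum>j'\<in>UNIV. (A $ i' $ j')\<^sup>2)"
  define f where "f = (\<lambda>(i, j). (A $ i $ j)\<^sup>2 / S)"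
  have S0: "S \<ge> 0"
    unfolding S_def by (intro sum_nonneg) auto
  have "S \<noteq> 0"
    using assms norm_matrix_eq_frobenius[of A] by (auto simp: S_def)
  have nn: "f p \<ge> 0" for p
    using S0 by (auto simp: f_def split: prod.splits)
  have "(\<Sum>p\<in>UNIV. f p) = (\<Sum>i\<in>UNIV. \<Sum>j\<in>UNIV. (A $ i $ j)\<^sup>2 / S)"
    unfolding f_def UNIV_Times_UNIV[symmetric] by (subst sum.cartesian_product[symmetric]) simp
  also have "\<dots> = 1"
    using \<open>S \<noteq> 0\<close> by (simp add: sum_divide_distrib[symmetric] S_def[symmetric])
  finally have "(\<Sum>p\<in>UNIV. f p) = 1" .
  then have "(\<integral>\<^sup>+p. ennreal (f p) \<partial>count_space UNIV) = 1"
    by (subst nn_integral_count_space_finite) (auto simp: nn)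
  then have "pmf (embed_pmf f) (i, j) = f (i, j)"
    by (intro pmf_embed_pmf) (auto simp: nn)
  then show ?thesis
    by (simp add: dsgs_index_pmf_def f_def S_def)
qed

definition dsgs_update ::
  "real^'n^'m \<Rightarrow> real^'m \<Rightarrow> real \<Rightarrow> real^'n \<Rightarrow> 'm \<times> 'n \<Rightarrow> real^'n" where
  "dsgs_update A b \<alpha> x = (\<lambda>(i, j). \<chi> k.
     if k = j then x $ j + \<alpha> * ((b $ i - (\<Sum>l\<in>UNIV. A $ i $ l * x $ l)) / A $ i $ j)
     else x $ k)"

text \<open>The conditional distribution of the next iterate, given that the current iterate is \<open>x\<close>:\<close>

definition dsgs_step ::
  "real^'n^'m \<Rightarrow> real^'m \<Rightarrow> real \<Rightarrow> real^'n \<Rightarrow> (real^'n) pmf" where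
  "dsgs_step A b \<alpha> x = map_pmf (dsgs_update A b \<alpha> x) (dsgs_index_pmf A)"

end

theory Submission
  imports Defs
begin

text \<open>
  Write \<open>S = \<parallel>A\<parallel>\<^sub>F\<^sup>2\<close>, \<open>\<beta> = A x - b\<close>, and let \<open>A\<^sub>j\<close> be column \<open>j\<close> of \<open>A\<close>.  Selecting the
  pair \<open>(i, j)\<close> replaces \<open>\<beta>\<close> by \<open>\<beta> - (\<alpha> \<beta>\<^sub>i / a\<^sub>i\<^sub>j) A\<^sub>j\<close>.  In the expansion of the squared norm of
  this vector the weight \<open>a\<^sub>i\<^sub>j\<^sup>2 / S\<close> cancels the denominators: the cross terms average to
  \<open>-2 \<alpha> \<parallel>A\<^sup>T \<beta>\<parallel>\<^sup>2 / S\<close>, and the quadratic terms average to at most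
  \<open>(\<alpha>\<^sup>2 / S) \<Sum>\<^sub>i\<^sub>j \<beta>\<^sub>i\<^sup>2 \<parallel>A\<^sub>j\<parallel>\<^sup>2 = \<alpha>\<^sup>2 \<parallel>\<beta>\<parallel>\<^sup>2\<close> (\<open>expected_residual_bound\<close>).

  Consistency of the system puts \<open>\<beta>\<close> into the range of \<open>A\<close>, where
  \<open>\<parallel>A\<^sup>T \<beta>\<parallel>\<^sup>2 \<ge> \<lambda> \<parallel>\<beta>\<parallel>\<^sup>2\<close> for the least nonzero eigenvalue \<open>\<lambda>\<close> of \<open>A A\<^sup>T\<close>
  (\<open>min_nonzero_eigenvalue_le_on_range\<close>).  With \<open>\<alpha> = \<lambda> / S\<close> the resulting factor is
  \<open>1 - 2 \<alpha>\<^sup>2 + \<alpha>\<^sup>2 = 1 - \<alpha>\<^sup>2\<close>.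

  The eigenvalue estimate is variational.  The Rayleigh quotient of \<open>A A\<^sup>T\<close> attains its minimum on
  the unit sphere of the invariant subspace \<open>range A\<close>, and the minimum is an eigenvalue
  (\<open>symmetric_Rayleigh_minimum\<close>).  This eigenvalue is nonzero because \<open>A\<^sup>T\<close> is injective on
  \<open>range A\<close>; hence it is at least \<open>\<lambda>\<close>.
\<close>

section \<open>Eigenvalues of symmetric matrices\<close>

lemma inner_matrix_vector_transpose:
  fixes A :: "real^'n^'m"
  shows "(A *v x) \<bullet> y = x \<bullet> (transpose A *v y)"
  using dot_lmul_matrix[of y A x] by (simp add: inner_commute)

text \<open>
  Eigenvectors of a symmetric matrix for distinct eigenvalues are orthogonal, and a finite-dimensional
  space has no infinite orthogonal family of nonzero vectors.
\<close>

lemma finite_eigenvalues_symmetric: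
  fixes M :: "real^'n^'n"
  assumes sym: "transpose M = M"
  shows "finite {l. eigenvalue M l}"
proof -
  define E where "E = {l. eigenvalue M l}"
  have "\<forall>l\<in>E. \<exists>v. v \<noteq> 0 \<and> M *v v = l *\<^sub>R v"
    by (auto simp: E_def eigenvalue_def)
  then obtain v where v: "\<And>l. l \<in> E \<Longrightarrow> v l \<noteq> 0" "\<And>l. l \<in> E \<Longrightarrow> M *v v l = l *\<^sub>R v l"
    by metis
  have inj: "inj_on v E"
    by (rule inj_onI) (metis v scaleR_right_imp_eq)
  have orth: "orthogonal (v k) (v l)" if "k \<in> E" "l \<in> E" "k \<noteq> l" for k l
  proof -
    have "k * (v k \<bullet> v l) = l * (v k \<bullet> v l)"
      using inner_matrix_vector_transpose[of M "v k" "v l"] that by (simp add: sym v)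
    then show ?thesis
      using \<open>k \<noteq> l\<close> by (simp add: orthogonal_def)
  qed
  have "finite (v ` E)"
    by (rule pairwise_orthogonal_imp_finite) (auto simp: pairwise_def intro: orth)
  then show ?thesis
    using inj finite_imageD unfolding E_def by blast
qed

text \<open>
  At a minimizer \<open>v\<close> of the Rayleigh quotient, with value \<open>\<mu>\<close>, the form
  \<open>q u = M u \<bullet> u - \<mu> (u \<bullet> u)\<close> is nonnegative on \<open>V\<close> and vanishes at \<open>v\<close>, so its first variation
  at \<open>v\<close> vanishes in all directions of \<open>V\<close>.  Invariance of \<open>V\<close> makes the residual
  \<open>M v - \<mu> v\<close> one of these directions, which forces it to be zero.
\<close>

lemma symmetric_Rayleigh_minimum:
  fixes M :: "real^'n^'n"
  assumes sym: "transpose M = M"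
    and sub: "subspace V" and inv: "\<And>u. u \<in> V \<Longrightarrow> M *v u \<in> V"
    and nontriv: "w \<in> V" "w \<noteq> 0"
  obtains \<mu> v where "v \<in> V" "v \<noteq> 0" "M *v v = \<mu> *\<^sub>R v"
    "\<And>u. u \<in> V \<Longrightarrow> \<mu> * (u \<bullet> u) \<le> (M *v u) \<bullet> u"
proof -
  let ?K = "V \<inter> sphere 0 1"
  have "compact ?K"
    by (simp add: closed_Int_compact closed_subspace sub)
  moreover have "(1 / norm w) *\<^sub>R w \<in> ?K"
    using nontriv sub by (auto simp: subspace_scale)
  then have "?K \<noteq> {}" by blast
  moreover have "continuous_on ?K (\<lambda>u. (M *v u) \<bullet> u)"
    by (intro continuous_intros)
  ultimately obtain v where vK: "v \<in> ?K"
    and vmin: "\<And>u. u \<in> ?K \<Longrightarrow> (M *v v) \<bullet> v \<le> (M *v u) \<bullet> u"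
    using continuous_attains_inf[of ?K "\<lambda>u. (M *v u) \<bullet> u"] by blast
  define \<mu> where "\<mu> = (M *v v) \<bullet> v"
  have v: "v \<in> V" "v \<bullet> v = 1" "v \<noteq> 0"
    using vK by (auto simp: dot_square_norm)
  have bound: "\<mu> * (u \<bullet> u) \<le> (M *v u) \<bullet> u" if "u \<in> V" for u
  proof (cases "u = 0")
    case False
    let ?n = "1 / norm u"
    have "?n *\<^sub>R u \<in> ?K"
      using that False sub by (auto simp: subspace_scale)
    then have "\<mu> \<le> ((M *v u) \<bullet> u) / (norm u)\<^sup>2"
      using vmin[of "?n *\<^sub>R u"]
      by (simp add: \<mu>_def matrix_vector_mult_scaleR power2_eq_square)
    then show ?thesis
      using False by (simp add: dot_square_norm pos_le_divide_eq)
  qed simp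
  define q where "q u = (M *v u) \<bullet> u - \<mu> * (u \<bullet> u)" for u
  define r where "r = M *v v - \<mu> *\<^sub>R v"
  have rV: "r \<in> V"
    unfolding r_def using sub inv v by (intro subspace_diff subspace_scale) auto
  have q_nonneg: "q u \<ge> 0" if "u \<in> V" for u
    using bound[OF that] by (simp add: q_def)
  have Mr: "(M *v r) \<bullet> v = (M *v v) \<bullet> r"
    by (metis inner_commute inner_matrix_vector_transpose sym)
  have rr: "r \<bullet> r = (M *v v) \<bullet> r - \<mu> * (v \<bullet> r)"
    by (simp add: r_def inner_diff_left inner_diff_right inner_commute algebra_simps)
  have expand: "q (v - s *\<^sub>R r) = s\<^sup>2 * q r - 2 * s * (r \<bullet> r)" for s
  proof -
    have Mvr: "M *v (v - s *\<^sub>R r) = M *v v - s *\<^sub>R (M *v r)"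
      by (simp add: matrix_vector_mult_diff_distrib matrix_vector_mult_scaleR)
    have "q (v - s *\<^sub>R r) = s\<^sup>2 * q r - 2 * s * ((M *v v) \<bullet> r - \<mu> * (v \<bullet> r))"
      unfolding q_def Mvr
      using Mr v(2) \<mu>_def
      by (simp add: inner_diff_left inner_diff_right inner_commute power2_eq_square algebra_simps)
    then show ?thesis
      by (simp only: rr)
  qed
  have "r = 0"
  proof (rule ccontr)
    assume "r \<noteq> 0"
    then have r0: "r \<bullet> r > 0" by simp
    \<comment> \<open>A step length for which the linear term dominates; the summand \<open>1\<close> avoids a case
        distinction on \<open>q r = 0\<close>.\<close>
    define s where "s = (r \<bullet> r) / (q r + 1)"
    have s: "s > 0" "s * (q r + 1) = r \<bullet> r"
      using r0 q_nonneg[OF rV] by (auto simp: s_def)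
    have "0 \<le> q (v - s *\<^sub>R r)"
      using sub rV v by (intro q_nonneg subspace_diff subspace_scale)
    also have "\<dots> = s * (s * q r - 2 * (r \<bullet> r))"
      by (simp add: expand power2_eq_square algebra_simps)
    finally have "s * q r \<ge> 2 * (r \<bullet> r)"
      using s(1) by (simp add: zero_le_mult_iff)
    then show False
      using s r0 by (simp add: algebra_simps)
  qed
  then have "M *v v = \<mu> *\<^sub>R v"
    by (simp add: r_def)
  with v bound that show ?thesis by blast
qed

section \<open>The least nonzero eigenvalue of the Gram matrix\<close>

lemma transpose_gram: "transpose (A ** transpose A) = A ** transpose (A :: real^'n^'m)"
  by (simp add: matrix_transpose_mul)

lemma gram_quadratic_form:
  fixes A :: "real^'n^'m"
  shows "((A ** transpose A) *v y) \<bullet> y = (norm (transpose A *v y))\<^sup>2"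
  by (simp add: matrix_vector_mul_assoc[symmetric] inner_matrix_vector_transpose dot_square_norm)

lemma eigenvalue_gram_nonneg:
  fixes A :: "real^'n^'m"
  assumes "eigenvalue (A ** transpose A) l"
  shows "l \<ge> 0"
proof -
  obtain v where v: "v \<noteq> 0" "(A ** transpose A) *v v = l *\<^sub>R v"
    using assms by (auto simp: eigenvalue_def)
  have "0 \<le> l * (v \<bullet> v)"
    using gram_quadratic_form[of A v] v(2) by simp
  then show ?thesis
    using v(1) by (simp add: zero_le_mult_iff dot_square_norm)
qed

text \<open>
  For \<open>y = A w\<close> in the kernel of \<open>A\<^sup>T\<close>, \<open>y \<bullet> y = w \<bullet> A\<^sup>T y = 0\<close>.
\<close>

lemma transpose_injective_on_range:
  fixes A :: "real^'n^'m"
  assumes "y \<in> range ((*v) A)" "transpose A *v y = 0"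
  shows "y = 0"
proof -
  obtain w where "y = A *v w"
    using assms(1) by blast
  then have "y \<bullet> y = w \<bullet> (transpose A *v y)"
    using inner_matrix_vector_transpose[of A w y] by simp
  then show ?thesis
    using assms(2) by simp
qed

text \<open>
  The Rayleigh minimum over the range of \<open>A\<close> belongs to the finite set whose minimum is the least
  nonzero eigenvalue.  In particular that set is nonempty, so its minimum is one of its elements and
  inherits nonnegativity.
\<close>

lemma min_nonzero_eigenvalue_le_on_range:
  fixes A :: "real^'n^'m"
  assumes "A \<noteq> 0"
  shows "min_nonzero_eigenvalue (A ** transpose A) \<ge> 0"
    and "y \<in> range ((*v) A) \<Longrightarrow>
      min_nonzero_eigenvalue (A ** transpose A) * (norm y)\<^sup>2 \<le> (norm (transpose A *v y))\<^sup>2"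
proof -
  let ?M = "A ** transpose A" and ?V = "range ((*v) A)"
  let ?E = "{l. eigenvalue ?M l \<and> l \<noteq> 0}"
  obtain w where w: "A *v w \<noteq> 0"
    using assms by (metis matrix_eq matrix_vector_mult_0)
  have sub: "subspace ?V"
    by (simp add: linear_subspace_image)
  have inv: "?M *v u \<in> ?V" for u
    by (simp add: matrix_vector_mul_assoc[symmetric])
  obtain \<mu> v where \<mu>: "v \<in> ?V" "v \<noteq> 0" "?M *v v = \<mu> *\<^sub>R v"
    "\<And>u. u \<in> ?V \<Longrightarrow> \<mu> * (u \<bullet> u) \<le> (?M *v u) \<bullet> u"
    using symmetric_Rayleigh_minimum[OF transpose_gram sub inv rangeI w] by metis
  have "\<mu> \<noteq> 0"
  proof
    assume "\<mu> = 0"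
    then have "transpose A *v v = 0"
      using gram_quadratic_form[of A v] \<mu>(3) by simp
    then show False
      using transpose_injective_on_range \<mu>(1,2) by blast
  qed
  then have \<mu>E: "\<mu> \<in> ?E"
    using \<mu>(2,3) by (auto simp: eigenvalue_def)
  have fin: "finite ?E"
    using finite_eigenvalues_symmetric[OF transpose_gram[of A]] by (rule rev_finite_subset) auto
  have "Min ?E \<in> ?E"
    using fin \<mu>E by (intro Min_in) auto
  then show "min_nonzero_eigenvalue ?M \<ge> 0"
    unfolding min_nonzero_eigenvalue_def using eigenvalue_gram_nonneg by blast
  show "min_nonzero_eigenvalue ?M * (norm y)\<^sup>2 \<le> (norm (transpose A *v y))\<^sup>2" if "y \<in> ?V"
  proof -
    have "min_nonzero_eigenvalue ?M \<le> \<mu>"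
      unfolding min_nonzero_eigenvalue_def using fin \<mu>E by (rule Min_le)
    then have "min_nonzero_eigenvalue ?M * (norm y)\<^sup>2 \<le> \<mu> * (norm y)\<^sup>2"
      by (simp add: mult_right_mono)
    also have "\<dots> \<le> (norm (transpose A *v y))\<^sup>2"
      using \<mu>(4)[OF that] by (simp only: gram_quadratic_form dot_square_norm)
    finally show ?thesis .
  qed
qed

section \<open>One step of the iteration\<close>

lemma residual_dsgs_update:
  fixes A :: "real^'n^'m"
  shows "A *v dsgs_update A b \<alpha> x (i, j) - b =
    (A *v x - b) - (\<alpha> * (A *v x - b) $ i / A $ i $ j) *\<^sub>R column j A"
proof -
  have "dsgs_update A b \<alpha> x (i, j) = x - (\<alpha> * (A *v x - b) $ i / A $ i $ j) *\<^sub>R axis j 1"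
    by (simp add: vec_eq_iff dsgs_update_def axis_def matrix_vector_mult_def
        diff_divide_distrib algebra_simps)
  then show ?thesis
    by (simp add: matrix_vector_mult_diff_distrib matrix_vector_mult_scaleR
        matrix_vector_mul_component matrix_vector_mult_basis)
qed

text \<open>
  Equality holds unless \<open>c = 0\<close>: for an entry that is never selected, the left-hand side is zero by
  the convention on division by zero, while the last term on the right may be positive.
\<close>

lemma weighted_norm_step_le:
  fixes \<beta> u :: "'a :: real_inner"
  shows "c\<^sup>2 * (norm (\<beta> - (\<alpha> * t / c) *\<^sub>R u))\<^sup>2 \<le>
    c\<^sup>2 * (norm \<beta>)\<^sup>2 - 2 * \<alpha> * (c * t * (\<beta> \<bullet> u)) + \<alpha>\<^sup>2 * (t\<^sup>2 * (norm u)\<^sup>2)"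
proof (cases "c = 0")
  case False
  have "c\<^sup>2 * (norm (\<beta> - (\<alpha> * t / c) *\<^sub>R u))\<^sup>2 = (norm (c *\<^sub>R \<beta> - (\<alpha> * t) *\<^sub>R u))\<^sup>2"
  proof -
    have "c *\<^sub>R (\<beta> - (\<alpha> * t / c) *\<^sub>R u) = c *\<^sub>R \<beta> - (\<alpha> * t) *\<^sub>R u"
      using False by (simp add: scaleR_diff_right)
    then show ?thesis
      by (metis norm_scaleR power_mult_distrib power2_abs)
  qed
  also have "\<dots> = c\<^sup>2 * (norm \<beta>)\<^sup>2 - 2 * \<alpha> * (c * t * (\<beta> \<bullet> u)) + \<alpha>\<^sup>2 * (t\<^sup>2 * (norm u)\<^sup>2)"
    unfolding power2_norm_eq_inner
    by (simp add: inner_diff_left inner_diff_right inner_commute power2_eq_square algebra_simps)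
  finally show ?thesis by simp
qed simp

lemma norm_matrix_sq_eq_sum:
  fixes A :: "real^'n^'m"
  shows "(norm A)\<^sup>2 = (\<Sum>i\<in>UNIV. \<Sum>j\<in>UNIV. (A $ i $ j)\<^sup>2)"
  by (simp add: norm_matrix_eq_frobenius sum_nonneg)

lemma norm_vector_sq_eq_sum: "(norm (y :: real^'n))\<^sup>2 = (\<Sum>i\<in>UNIV. (y $ i)\<^sup>2)"
  by (simp add: norm_vec_def L2_set_def sum_nonneg)

lemma norm_matrix_sq_eq_sum_columns:
  fixes A :: "real^'n^'m"
  shows "(norm A)\<^sup>2 = (\<Sum>j\<in>UNIV. (norm (column j A))\<^sup>2)"
  unfolding norm_matrix_sq_eq_sum norm_vector_sq_eq_sum
  by (subst sum.swap) (simp add: column_def)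

lemma expectation_dsgs_step:
  fixes A :: "real^'n^'m" and f :: "real^'n \<Rightarrow> real"
  assumes "A \<noteq> 0"
  shows "measure_pmf.expectation (dsgs_step A b \<alpha> x) f =
    (\<Sum>i\<in>UNIV. \<Sum>j\<in>UNIV. (A $ i $ j)\<^sup>2 * f (dsgs_update A b \<alpha> x (i, j))) / (norm A)\<^sup>2"
proof -
  have "measure_pmf.expectation (dsgs_step A b \<alpha> x) f =
    (\<Sum>p\<in>UNIV. f (dsgs_update A b \<alpha> x p) * pmf (dsgs_index_pmf A) p)"
    unfolding dsgs_step_def integral_map_pmf by (rule integral_measure_pmf_real) auto
  also have "\<dots> = (\<Sum>i\<in>UNIV. \<Sum>j\<in>UNIV.
      f (dsgs_update A b \<alpha> x (i, j)) * pmf (dsgs_index_pmf A) (i, j))"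
    unfolding UNIV_Times_UNIV[symmetric] by (subst sum.cartesian_product) (simp add: case_prod_beta)
  also have "\<dots> = (\<Sum>i\<in>UNIV. \<Sum>j\<in>UNIV.
      (A $ i $ j)\<^sup>2 * f (dsgs_update A b \<alpha> x (i, j)) / (norm A)\<^sup>2)"
    by (simp add: pmf_dsgs_index_pmf[OF assms] norm_matrix_sq_eq_sum mult.commute)
  finally show ?thesis
    by (simp add: sum_divide_distrib)
qed

text \<open>
  Summed over all pairs, the cross terms of \<open>weighted_norm_step_le\<close> form the quadratic form
  \<open>\<Sum>\<^sub>j (\<Sum>\<^sub>i a\<^sub>i\<^sub>j \<beta>\<^sub>i) (\<beta> \<bullet> A\<^sub>j) = \<parallel>A\<^sup>T \<beta>\<parallel>\<^sup>2\<close>, and the quadratic terms factor as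
  \<open>(\<Sum>\<^sub>i \<beta>\<^sub>i\<^sup>2) (\<Sum>\<^sub>j \<parallel>A\<^sub>j\<parallel>\<^sup>2)\<close>.
\<close>

lemma expected_residual_bound:
  fixes A :: "real^'n^'m" and b :: "real^'m" and x :: "real^'n" and \<alpha> :: real
  assumes "A \<noteq> 0"
  defines "\<beta> \<equiv> A *v x - b"
  shows "measure_pmf.expectation (dsgs_step A b \<alpha> x) (\<lambda>x'. (norm (A *v x' - b))\<^sup>2) \<le>
    (1 + \<alpha>\<^sup>2) * (norm \<beta>)\<^sup>2 - 2 * \<alpha> * (norm (transpose A *v \<beta>))\<^sup>2 / (norm A)\<^sup>2"
proof -
  let ?a = "\<lambda>i j. A $ i $ j" and ?S = "(norm A)\<^sup>2"
  have S: "?S > 0"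
    using assms by simp
  have comp: "(transpose A *v \<beta>) $ j = \<beta> \<bullet> column j A" for j
    by (simp add: matrix_vector_mul_component inner_commute row_def column_def transpose_def)
  have cross: "(\<Sum>i\<in>UNIV. \<Sum>j\<in>UNIV. ?a i j * \<beta> $ i * (\<beta> \<bullet> column j A)) =
      (norm (transpose A *v \<beta>))\<^sup>2"
  proof -
    have "(\<Sum>i\<in>UNIV. \<Sum>j\<in>UNIV. ?a i j * \<beta> $ i * (\<beta> \<bullet> column j A)) =
      (\<Sum>j\<in>UNIV. (\<Sum>i\<in>UNIV. \<beta> $ i * ?a i j) * (\<beta> \<bullet> column j A))"
      by (subst sum.swap) (simp add: sum_distrib_left mult.commute)
    also have "\<dots> = (\<Sum>j\<in>UNIV. (\<beta> \<bullet> column j A)\<^sup>2)"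
      by (simp add: inner_vec_def column_def power2_eq_square)
    finally show ?thesis
      by (simp only: norm_vector_sq_eq_sum comp)
  qed
  have quad: "(\<Sum>i\<in>UNIV. \<Sum>j\<in>UNIV. (\<beta> $ i)\<^sup>2 * (norm (column j A))\<^sup>2) = (norm \<beta>)\<^sup>2 * ?S"
    unfolding norm_matrix_sq_eq_sum_columns norm_vector_sq_eq_sum[of \<beta>]
    by (rule sum_product[symmetric])
  have "(\<Sum>i\<in>UNIV. \<Sum>j\<in>UNIV. (?a i j)\<^sup>2 * (norm (A *v dsgs_update A b \<alpha> x (i, j) - b))\<^sup>2) \<le>
    (\<Sum>i\<in>UNIV. \<Sum>j\<in>UNIV. (?a i j)\<^sup>2 * (norm \<beta>)\<^sup>2
      - 2 * \<alpha> * (?a i j * \<beta> $ i * (\<beta> \<bullet> column j A))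
      + \<alpha>\<^sup>2 * ((\<beta> $ i)\<^sup>2 * (norm (column j A))\<^sup>2))"
    unfolding residual_dsgs_update \<beta>_def[symmetric] by (intro sum_mono weighted_norm_step_le)
  also have "\<dots> = ?S * (norm \<beta>)\<^sup>2 - 2 * \<alpha> * (norm (transpose A *v \<beta>))\<^sup>2
      + \<alpha>\<^sup>2 * ((norm \<beta>)\<^sup>2 * ?S)"
    unfolding cross[symmetric] quad[symmetric] unfolding norm_matrix_sq_eq_sum
    by (simp only: sum.distrib sum_subtractf sum_distrib_left sum_distrib_right)
  also have "\<dots> = ((1 + \<alpha>\<^sup>2) * (norm \<beta>)\<^sup>2
      - 2 * \<alpha> * (norm (transpose A *v \<beta>))\<^sup>2 / ?S) * ?S"
    using S by (simp add: field_simps)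
  finally show ?thesis
    unfolding expectation_dsgs_step[OF assms(1)] using S by (subst pos_divide_le_eq)
qed

theorem theorem2:
  fixes A :: "real^'n^'m" and b :: "real^'m" and x :: "real^'n" and \<alpha> :: real
  assumes "A \<noteq> 0"
    and "\<exists>z. A *v z = b"
    and "\<alpha> = 1 / (norm A)\<^sup>2 * min_nonzero_eigenvalue (A ** transpose A)"
  shows "measure_pmf.expectation (dsgs_step A b \<alpha> x) (\<lambda>x'. (norm (A *v x' - b))\<^sup>2)
           \<le> (norm (A *v x - b))\<^sup>2 *
              (1 - (1 / (norm A)\<^sup>2 * min_nonzero_eigenvalue (A ** transpose A))\<^sup>2)"
proof -
  let ?\<beta> = "A *v x - b" and ?l = "min_nonzero_eigenvalue (A ** transpose A)"
  have S: "(norm A)\<^sup>2 > 0"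
    using assms(1) by simp
  obtain z where "A *v z = b"
    using assms(2) by blast
  then have "?\<beta> = A *v (x - z)"
    by (simp add: matrix_vector_mult_diff_distrib)
  then have "?l * (norm ?\<beta>)\<^sup>2 \<le> (norm (transpose A *v ?\<beta>))\<^sup>2"
    using min_nonzero_eigenvalue_le_on_range(2)[OF assms(1)] by blast
  then have "\<alpha> * (norm ?\<beta>)\<^sup>2 \<le> (norm (transpose A *v ?\<beta>))\<^sup>2 / (norm A)\<^sup>2"
    using S by (simp add: assms(3) divide_right_mono)
  moreover have "\<alpha> \<ge> 0"
    using min_nonzero_eigenvalue_le_on_range(1)[OF assms(1)] by (simp add: assms(3))
  ultimately have "2 * \<alpha> * (\<alpha> * (norm ?\<beta>)\<^sup>2) \<le>
      2 * \<alpha> * ((norm (transpose A *v ?\<beta>))\<^sup>2 / (norm A)\<^sup>2)"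
    by (intro mult_left_mono) auto
  then have "measure_pmf.expectation (dsgs_step A b \<alpha> x) (\<lambda>x'. (norm (A *v x' - b))\<^sup>2)
      \<le> (norm ?\<beta>)\<^sup>2 * (1 - \<alpha>\<^sup>2)"
    using expected_residual_bound[OF assms(1), of b \<alpha> x]
    by (simp add: power2_eq_square algebra_simps)
  then show ?thesis
    by (simp only: assms(3))
qed

end
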